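(* Let $\epsilon \in [\frac{1}{11},\frac{1}{2})$ be a real number. Let $p$ be a prime satisfying $$ \log\log p > \frac{\log 6.83}{\frac{1}{2}-\epsilon} \qquad \text{and} \qquad \frac{\phi(p-1)}{p-1}\leq \frac{1}{2}-\epsilon . $$ Then there is a QNRNP $g$ modulo $p$ and an integer $x \in [1,p-1]$ such that $x$ is a QNRNP modulo $p$ and $g^x \equiv x \pmod{p}$.
   Context: For an odd prime $p$, a primitive root modulo $p$ is an integer whose class generates the cyclic group $(\mathbb{Z}/p\mathbb{Z})^*$. An integer is called a QNRNP modulo $p$ if it is a quadratic non-residue modulo $p$ (in particular coprime to $p$) which is not a primitive root modulo $p$. Here $\phi$ is Euler's totient function and $\log$ is the natural logarithm. *)

theory Defs
  imports Complex_Main "HOL-Number_Theory.Number_Theory"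
begin

(* residue_primroot lives on nat, so an integer is represented by its least
   nonnegative residue; primitive_root_iff_generates relates this to generation. *)
definition primitive_root :: "nat \<Rightarrow> int \<Rightarrow> bool" where
  "primitive_root p g \<longleftrightarrow> residue_primroot p (nat (g mod int p))"

lemma primitive_root_iff_generates:
  assumes p: "prime p"
  shows "primitive_root p g \<longleftrightarrow>
    coprime g (int p) \<and> (\<forall>y. coprime y (int p) \<longrightarrow> (\<exists>k. [g ^ k = y] (mod int p)))"
proof -
  define a where "a = nat (g mod int p)"
  have p1: "p > 1" using p prime_gt_1_nat by blast
  have a_int: "int a = g mod int p" using p1 by (simp add: a_def)
  have ga: "[g = int a] (mod int p)" by (simp add: a_int cong_def)
  have cop: "coprime g (int p) \<longleftrightarrow> coprime p a"
    by (metis a_int coprime_commute coprime_int_iff coprime_mod_left_iff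
        gr_implies_not0 of_nat_eq_0_iff p1)
  have pow: "[g ^ k = int (a ^ k)] (mod int p)" for k
    using cong_pow[OF ga, of k] by simp
  show ?thesis
  proof
    assume "primitive_root p g"
    hence pr: "residue_primroot p a" by (simp add: primitive_root_def a_def)
    hence cp: "coprime p a" by (simp add: residue_primroot_def)
    have bij: "bij_betw (\<lambda>i. a ^ i mod p) {..<totient p} (totatives p)"
      by (rule residue_primroot_is_generator[OF p1 pr])
    have "\<exists>k. [g ^ k = y] (mod int p)" if y: "coprime y (int p)" for y
    proof -
      define b where "b = nat (y mod int p)"
      have b: "int b = y mod int p" using p1 by (simp add: b_def)
      have "coprime (y mod int p) (int p)" using y p1 by simp
      hence cb: "coprime b p" by (simp flip: b)
      have "int b < int p" using p1 by (simp add: b)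
      moreover have "b \<noteq> 0" using cb p1 by (intro notI) simp
      ultimately have "b \<in> totatives p" using cb by (simp add: totatives_def)
      hence "b \<in> (\<lambda>i. a ^ i mod p) ` {..<totient p}"
        by (simp only: bij_betw_imp_surj_on[OF bij])
      then obtain i where i: "b = a ^ i mod p" by (rule imageE)
      have "int (a ^ i) mod int p = int b" using i zmod_int[of "a ^ i" p] by simp
      hence "[int (a ^ i) = y] (mod int p)" by (simp add: cong_def b)
      thus ?thesis using pow cong_trans by blast
    qed
    thus "coprime g (int p) \<and> (\<forall>y. coprime y (int p) \<longrightarrow> (\<exists>k. [g ^ k = y] (mod int p)))"
      using cp cop by blast
  next
    assume gen: "coprime g (int p) \<and> (\<forall>y. coprime y (int p) \<longrightarrow> (\<exists>k. [g ^ k = y] (mod int p)))"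
    hence cp: "coprime p a" using cop by blast
    have op: "ord p a > 0" using cp by (simp add: coprime_ord)
    have "totatives p \<subseteq> (\<lambda>i. a ^ i mod p) ` {..<ord p a}"
    proof
      fix y assume y: "y \<in> totatives p"
      hence yc: "coprime (int y) (int p)" by (simp add: totatives_def)
      have ylt: "y < p" using totatives_less[OF y p1] .
      obtain k where "[g ^ k = int y] (mod int p)" using gen yc by blast
      hence "[int (a ^ k) = int y] (mod int p)" using pow cong_sym cong_trans by blast
      hence k: "[a ^ k = y] (mod p)" by (simp only: cong_int_iff)
      have "[a ^ (k mod ord p a) = a ^ k] (mod p)"
        using order_divides_expdiff[OF cp, of "k mod ord p a" k] by (simp add: cong_def)
      hence "a ^ (k mod ord p a) mod p = y" using k ylt by (simp add: cong_def)
      thus "y \<in> (\<lambda>i. a ^ i mod p) ` {..<ord p a}" using op by force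
    qed
    hence "card (totatives p) \<le> card ((\<lambda>i. a ^ i mod p) ` {..<ord p a})"
      by (intro card_mono) auto
    also have "\<dots> \<le> ord p a" using card_image_le[of "{..<ord p a}"] by simp
    finally have "totient p \<le> ord p a" by (simp add: totient_def)
    moreover have "ord p a \<le> totient p"
      using order_divides_totient[OF cp] p1 by (intro dvd_imp_le) auto
    ultimately show "primitive_root p g"
      using cp p1 by (simp add: primitive_root_def residue_primroot_def flip: a_def)
  qed
qed

definition quadratic_nonresidue :: "nat \<Rightarrow> int \<Rightarrow> bool" where
  "quadratic_nonresidue p a \<longleftrightarrow> coprime a (int p) \<and> \<not> QuadRes (int p) a"

definition QNRNP :: "nat \<Rightarrow> int \<Rightarrow> bool" where
  "QNRNP p a \<longleftrightarrow> quadratic_nonresidue p a \<and> \<not> primitive_root p a"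

end

theory Submission
  imports "HOL-Analysis.Analysis" Defs
begin

text \<open>
  If x is a QNRNP coprime to p - 1 and x y = 1 modulo p - 1, then g = x^y is a QNRNP with g^x = x
  modulo p. The hypothesis on the totient provides an odd prime factor l of p - 1 of size O(log p),
  and every quadratic non-residue that is an l-th power is a QNRNP. These elements form a coset of
  the subgroup of index 2 l, so by Parseval the nontrivial Fourier coefficients of its indicator
  function are at most sqrt p. As in the Polya--Vinogradov inequality, the coset then contains the
  expected number of multiples of each divisor of p - 1, up to sqrt p (1 + log p), and sieving by
  the prime factors of p - 1 leaves an element coprime to p - 1. The bounds on epsilon and p enter
  only through log p > 108 and \<open>\<phi>(p - 1) / (p - 1) \<le> 9/22\<close>.
\<close>

section \<open>Exponential sums\<close>

definition add_char :: "nat \<Rightarrow> int \<Rightarrow> complex" where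
  "add_char p n = cis (2 * pi * of_int n / of_nat p)"

lemma add_char_0 [simp]: "add_char p 0 = 1"
  by (simp add: add_char_def)

lemma norm_add_char [simp]: "norm (add_char p n) = 1"
  by (simp add: add_char_def)

lemma add_char_add: "add_char p (m + n) = add_char p m * add_char p n"
  by (simp add: add_char_def cis_mult add_divide_distrib ring_distribs)

lemma add_char_mult_nat: "add_char p (int k * n) = add_char p n ^ k"
  by (simp add: add_char_def Complex.DeMoivre mult_ac)

lemma cnj_add_char: "cnj (add_char p n) = add_char p (- n)"
  by (simp add: add_char_def cis_cnj)

lemma add_char_eq_1_iff:
  assumes "p > 0"
  shows "add_char p n = 1 \<longleftrightarrow> int p dvd n"
proof
  assume "add_char p n = 1"
  hence "cos (2 * pi * of_int n / of_nat p) = 1"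
    by (auto simp: add_char_def complex_eq_iff)
  then obtain k :: int where "2 * pi * of_int n / of_nat p = of_int k * 2 * pi"
    using cos_one_2pi_int by blast
  hence "real_of_int n = real_of_int (k * int p)"
    using assms by (simp add: field_simps)
  thus "int p dvd n"
    by (simp only: of_int_eq_iff) simp
next
  assume "int p dvd n"
  then obtain k where "n = int p * k" ..
  hence "add_char p n = cis (2 * pi * of_int k)"
    using assms by (simp add: add_char_def mult_ac)
  thus "add_char p n = 1"
    by (simp only: cis_multiple_2pi Ints_of_int)
qed

lemma add_char_cong:
  assumes "p > 0" "[m = n] (mod int p)"
  shows "add_char p m = add_char p n"
proof -
  have "add_char p (m - n) = 1"
    using assms by (simp add: add_char_eq_1_iff cong_iff_dvd_diff)
  thus ?thesis
    using add_char_add[of p "m - n" n] by simp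
qed

text \<open>Orthogonality: a geometric sum whose ratio is a \<open>p\<close>-th root of unity. It is
  used to detect congruences modulo \<open>p\<close>.\<close>

lemma sum_add_char:
  assumes "p > 0"
  shows "(\<Sum>s<p. add_char p (int s * n)) = (if int p dvd n then of_nat p else 0)"
proof (cases "int p dvd n")
  case True
  thus ?thesis
    using assms by (simp add: add_char_mult_nat add_char_eq_1_iff[THEN iffD2])
next
  case False
  have "add_char p n ^ p = 1"
    using assms by (simp flip: add_char_mult_nat add: add_char_eq_1_iff)
  thus ?thesis
    using False assms by (simp add: add_char_mult_nat geometric_sum add_char_eq_1_iff)
qed

section \<open>Incomplete geometric sums of characters\<close>

text \<open>Jordan's inequality: sine is concave on [0, pi/2] and so lies above its chord
  there.\<close>

lemma sin_ge_linear:
  assumes "0 \<le> t" "t \<le> 1 / 2"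
  shows "2 * t \<le> sin (pi * t)"
proof -
  have "convex_on {0..pi/2} (\<lambda>x. - sin x)"
    by (rule f''_ge0_imp_convex[where f' = "\<lambda>x. - cos x" and f'' = sin])
       (auto intro!: derivative_eq_intros sin_ge_zero)
  from convex_onD[OF this, of "2 * t" 0 "pi / 2"] show ?thesis
    using assms by (simp add: mult_ac)
qed

text \<open>The geometric sum is at most 1 / |sin(pi s / p)|, to which Jordan's inequality applies.
  Replacing the reciprocal of the minimum of \<open>s\<close> and \<open>p - s\<close> by the sum of
  both reciprocals prepares a harmonic sum over \<open>s\<close>.\<close>

lemma norm_sum_add_char_le:
  assumes "0 < s" "s < p"
  shows "norm (\<Sum>y=1..M. add_char p (int s * int y)) \<le> real p / 2 * (1 / real s + 1 / real (p - s))"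
proof -
  define z where "z = add_char p (int s)"
  have z1: "z \<noteq> 1"
    using assms by (auto simp: z_def add_char_eq_1_iff zdvd_not_zless)
  have "(\<Sum>y=1..M. add_char p (int s * int y)) = (\<Sum>y=1..M. z ^ y)"
    by (simp add: z_def flip: add_char_mult_nat) (simp add: mult.commute)
  also have "\<dots> = z * (\<Sum>y<M. z ^ y)"
    by (induction M) (simp_all add: ring_distribs)
  also have "norm \<dots> = norm (z ^ M - 1) / norm (z - 1)"
    using z1 by (simp add: geometric_sum norm_mult norm_divide) (simp add: z_def)
  also have "norm (z ^ M - 1) \<le> 2"
    using norm_triangle_ineq4[of "z ^ M" 1] by (simp add: z_def norm_power)
  hence "norm (z ^ M - 1) / norm (z - 1) \<le> 2 / norm (z - 1)"
    by (simp add: divide_right_mono)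
  also have "norm (z - 1) = 2 * \<bar>sin (pi * (real s / real p))\<bar>"
    using dist_exp_i_1[of "2 * pi * real s / real p"] 
    by (simp add: z_def add_char_def cis_conv_exp mult_ac)
  also have "2 / (2 * \<bar>sin (pi * (real s / real p))\<bar>) \<le> real p / 2 * (1 / real s + 1 / real (p - s))"
  proof -
    \<comment> \<open>The distance from \<open>s\<close> to the nearest multiple of
      \<open>p\<close>; the reflection t -> pi - t preserves the sine and brings the argument into
      the range of Jordan's inequality.\<close>
    define m where "m = min s (p - s)"
    have m: "0 < m" "2 * m \<le> p" using assms by (auto simp: m_def)
    have "sin (pi * (real s / real p)) = sin (pi * (real m / real p))"
    proof (cases "s \<le> p - s")
      case False
      have "sin (pi * (real m / real p)) = sin (pi - pi * (real s / real p))"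
        using False assms by (simp add: m_def of_nat_diff field_simps)
      thus ?thesis by (simp only: sin_pi_minus)
    qed (simp add: m_def)
    moreover have "2 * (real m / real p) \<le> sin (pi * (real m / real p))"
      using m by (intro sin_ge_linear) (auto simp: field_simps)
    moreover have "2 * (real m / real p) > 0" using m by simp
    ultimately have "2 / (2 * \<bar>sin (pi * (real s / real p))\<bar>) \<le> 1 / (2 * (real m / real p))"
      by (metis abs_of_nonneg divide_divide_eq_left divide_left_mono divide_self_if less_le_trans mult_pos_pos
          order_less_imp_le zero_le_one zero_neq_numeral)
    also have "\<dots> = real p / 2 * (1 / real m)" using m by simp
    also have "\<dots> \<le> real p / 2 * (1 / real s + 1 / real (p - s))"
      using assms by (intro mult_left_mono) (auto simp: m_def min_def)
    finally show ?thesis .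
  qed
  finally show ?thesis .
qed

text \<open>The difference between the harmonic number and the logarithm decreases from its value 1
  at the first index.\<close>

lemma sum_inverse_le_ln:
  assumes "p > 1"
  shows "(\<Sum>s=1..p-1. 1 / real s) \<le> 1 + ln (real p)"
proof -
  have "(\<Sum>s=1..p-1. 1 / real s) = harm (p - 1)"
    by (simp add: harm_def divide_inverse)
  also have "\<dots> \<le> 1 + ln (real (p - 1))"
    using euler_mascheroni_sequence_decreasing[of 1 "p - 1"] assms by (simp add: harm_def add.commute flip: diff_le_eq)
  also have "ln (real (p - 1)) \<le> ln (real p)"
    using assms by simp
  finally show ?thesis by simp
qed

lemma sum_norm_sum_add_char_le:
  assumes "p > 1"
  shows "(\<Sum>s=1..p-1. norm (\<Sum>y=1..M. add_char p (int s * int y))) \<le> real p * (1 + ln (real p))"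
proof -
  have "(\<Sum>s=1..p-1. norm (\<Sum>y=1..M. add_char p (int s * int y)))
      \<le> (\<Sum>s=1..p-1. real p / 2 * (1 / real s + 1 / real (p - s)))"
    using assms by (intro sum_mono norm_sum_add_char_le) auto
  also have "\<dots> = real p / 2 * ((\<Sum>s=1..p-1. 1 / real s) + (\<Sum>s=1..p-1. 1 / real (p - s)))"
    by (simp only: sum.distrib flip: sum_distrib_left)
  also have "(\<Sum>s=1..p-1. 1 / real (p - s)) = (\<Sum>s=1..p-1. 1 / real s)"
    by (rule sum.reindex_bij_witness[of _ "\<lambda>s. p - s" "\<lambda>s. p - s"]) auto
  also have "real p / 2 * ((\<Sum>s=1..p-1. 1 / real s) + (\<Sum>s=1..p-1. 1 / real s))
      \<le> real p / 2 * ((1 + ln (real p)) + (1 + ln (real p)))"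
    using sum_inverse_le_ln[OF assms] by (intro mult_left_mono add_mono) auto
  finally show ?thesis by (simp add: algebra_simps)
qed

text \<open>Expanding the product and summing over \<open>t\<close> first leaves, by orthogonality,
  the number of solutions of a congruence. With equal families this is Parseval; with a set and the
  multiples of \<open>D\<close> it counts those multiples in the set.\<close>

lemma sum_add_char_times:
  assumes "p > 0"
  shows "(\<Sum>t<p. (\<Sum>x\<in>A. add_char p (int t * f x)) * cnj (\<Sum>y\<in>B. add_char p (int t * h y)))
       = of_nat p * of_nat (\<Sum>x\<in>A. \<Sum>y\<in>B. if [f x = h y] (mod int p) then 1 else 0)"
proof -
  have *: "add_char p (int t * f x) * cnj (add_char p (int t * h y)) = add_char p (int t * (f x - h y))" for t x y
    by (simp add: cnj_add_char right_diff_distrib flip: add_char_add)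
  have "(\<Sum>t<p. (\<Sum>x\<in>A. add_char p (int t * f x)) * cnj (\<Sum>y\<in>B. add_char p (int t * h y)))
      = (\<Sum>t<p. \<Sum>x\<in>A. \<Sum>y\<in>B. add_char p (int t * (f x - h y)))"
    by (simp add: sum_product cnj_sum *)
  also have "\<dots> = (\<Sum>x\<in>A. \<Sum>y\<in>B. \<Sum>t<p. add_char p (int t * (f x - h y)))"
    by (subst sum.swap, intro sum.cong refl, subst sum.swap) simp
  also have "\<dots> = (\<Sum>x\<in>A. \<Sum>y\<in>B. of_nat p * of_nat (if [f x = h y] (mod int p) then 1 else 0))"
    using assms by (intro sum.cong refl) (auto simp: sum_add_char cong_iff_dvd_diff)
  finally show ?thesis
    by (simp add: sum_distrib_left)
qed

(* Parseval bounds the sum over the orbit t u^i, on which the coefficient is constant. *)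
lemma norm_coset_sum_le:
  fixes a u :: int
  assumes p0: "p > 0" and u: "[u ^ k = 1] (mod int p)" and k: "k > 0"
    and inj: "\<And>i j. i < k \<Longrightarrow> j < k \<Longrightarrow> [u ^ i = u ^ j] (mod int p) \<Longrightarrow> i = j"
    and a: "coprime a (int p)" and t: "coprime t (int p)"
  shows "norm (\<Sum>j<k. add_char p (t * (a * u ^ j))) \<le> sqrt (real p)"
proof -
  define F where "F t = (\<Sum>j<k. add_char p (t * (a * u ^ j)))" for t :: int
  have F_cong: "F s = F t" if "[s = t] (mod int p)" for s t
    unfolding F_def using p0 that by (intro sum.cong refl add_char_cong cong_mult) auto
  have F_u: "F (s * u) = F s" for s
  proof -
    have "F (s * u) = (\<Sum>j<k. add_char p (s * (a * u ^ Suc j)))"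
      by (simp add: F_def mult_ac)
    \<comment> \<open>Multiplying by \<open>u\<close> shifts the summation index; the two boundary
      terms, at 0 and at \<open>k\<close>, cancel because \<open>u ^ k\<close> is 1 modulo
      \<open>p\<close>.\<close>
    also have "\<dots> = (\<Sum>j<Suc k. add_char p (s * (a * u ^ j))) - add_char p (s * a)"
      by (subst sum.lessThan_Suc_shift) simp
    also have "\<dots> = F s + (add_char p (s * (a * u ^ k)) - add_char p (s * a))"
      by (simp add: F_def)
    also have "add_char p (s * (a * u ^ k)) = add_char p (s * (a * 1))"
      using p0 u by (intro add_char_cong cong_mult) auto
    finally show ?thesis by simp
  qed
  have F_pow: "F (t * u ^ i) = F t" for i
  proof (induction i)
    case (Suc i)
    thus ?case using F_u[of "t * u ^ i"] by (simp add: mult_ac)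
  qed simp
  define r where "r i = nat (t * u ^ i mod int p)" for i
  have r: "int (r i) = t * u ^ i mod int p" for i using p0 by (simp add: r_def)
  have r_less: "r i < p" for i
    using p0 pos_mod_bound[of "int p" "t * u ^ i"] by (simp flip: r)
  have inj_r: "inj_on r {..<k}"
  proof (rule inj_onI)
    fix i j assume ij: "i \<in> {..<k}" "j \<in> {..<k}" "r i = r j"
    hence "[t * u ^ i = t * u ^ j] (mod int p)"
      unfolding cong_def by (simp flip: r)
    hence "[u ^ i = u ^ j] (mod int p)"
      using t by (simp add: cong_mult_lcancel)
    thus "i = j" using ij inj by simp
  qed
  have "complex_of_real (\<Sum>s<p. (norm (F (int s)))\<^sup>2) = (\<Sum>s<p. F (int s) * cnj (F (int s)))"
    by (simp only: of_real_sum complex_norm_square)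
  also have "\<dots> = of_nat p * of_nat (\<Sum>i<k. \<Sum>j<k. if [a * u ^ i = a * u ^ j] (mod int p) then 1 else 0)"
    unfolding F_def by (rule sum_add_char_times[OF p0])
  also have "(\<Sum>i<k. \<Sum>j<k. if [a * u ^ i = a * u ^ j] (mod int p) then 1 else 0 :: nat)
           = (\<Sum>i<k. \<Sum>j<k. if i = j then 1 else 0)"
    \<comment> \<open>As \<open>a\<close> is invertible and the powers of \<open>u\<close> are
      distinct, only the diagonal pairs are counted.\<close>
    using a inj by (intro sum.cong refl) (auto simp: cong_mult_lcancel)
  also have "\<dots> = k" by simp
  also have "of_nat p * complex_of_nat k = complex_of_real (real p * real k)" by simp
  finally have parseval: "(\<Sum>s<p. (norm (F (int s)))\<^sup>2) = real p * real k"
    by (simp only: of_real_eq_iff)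
  \<comment> \<open>The \<open>k\<close> distinct residues \<open>r i\<close> all carry the same
    value of \<open>F\<close>, so together they contribute at most the full Parseval sum.\<close>
  have "real k * (norm (F t))\<^sup>2 = (\<Sum>i<k. (norm (F (int (r i))))\<^sup>2)"
    using F_cong[of "int (r i)" "t * u ^ i" for i] by (simp add: r cong_def F_pow)
  also have "\<dots> = (\<Sum>s\<in>r ` {..<k}. (norm (F (int s)))\<^sup>2)"
    using inj_r by (simp add: sum.reindex)
  also have "\<dots> \<le> (\<Sum>s<p. (norm (F (int s)))\<^sup>2)"
    using r_less by (intro sum_mono2) auto
  finally have "real k * (norm (F t))\<^sup>2 \<le> real p * real k" by (simp only: parseval)
  hence "(norm (F t))\<^sup>2 \<le> real p" using k by (simp add: mult.commute)
  thus ?thesis unfolding F_def by (rule real_le_rsqrt)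
qed

text \<open>Orthogonality writes \<open>p\<close> times the count as a sum over frequencies
  \<open>t\<close>. The frequency 0 gives the main term; the others are bounded by \<open>K\<close>
  times the sum of the norms of incomplete geometric sums, as in Polya-Vinogradov.\<close>

lemma card_multiples_estimate:
  assumes p: "prime p" and A: "A \<subseteq> {1..p-1}" and D: "D dvd p - 1"
    and K: "\<And>t. 0 < t \<Longrightarrow> t < p \<Longrightarrow> norm (\<Sum>x\<in>A. add_char p (int t * int x)) \<le> K"
  shows "\<bar>real (card {x\<in>A. D dvd x}) - real (card A) * real (p - 1) / real p / real D\<bar> \<le> K * (1 + ln (real p))"
proof -
  define M where "M = (p - 1) div D"
  have p1: "p > 1" using p prime_gt_1_nat by blast
  have K0: "K \<ge> 0" using order_trans[OF norm_ge_zero K[of 1]] p1 by simp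
  have DM: "D * M = p - 1" using D by (simp add: M_def)
  hence D0: "D > 0" using p1 by (cases D) auto
  have D_less: "D < p" using dvd_imp_le[OF D] p1 by simp
  have copD: "coprime D p" using p D0 D_less
    by (metis coprime_commute nat_dvd_not_less prime_imp_coprime_nat)
  have fin: "finite A" using A finite_subset by blast
  define F where "F t = (\<Sum>x\<in>A. add_char p (int t * int x))" for t
  define G where "G t = (\<Sum>y=1..M. add_char p (int t * (int D * int y)))" for t
  have count: "(\<Sum>x\<in>A. \<Sum>y=1..M. if [int x = int D * int y] (mod int p) then 1 else 0 :: nat)
      = card {x\<in>A. D dvd x}"
  proof -
    have "(\<Sum>y=1..M. if [int x = int D * int y] (mod int p) then 1 else 0 :: nat)
        = (if D dvd x then 1 else 0)" if x: "x \<in> A" for x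
    proof -
      have xp: "0 < x" "x \<le> p - 1" using x A by auto
      have "[int x = int D * int y] (mod int p) \<longleftrightarrow> D dvd x \<and> y = x div D" if y: "y \<in> {1..M}" for y
      proof -
        \<comment> \<open>Both sides of the congruence lie below \<open>p\<close>, so it is an
          equality.\<close>
        have "D * y \<le> p - 1" using y DM by (metis atLeastAtMost_iff mult_le_mono2)
        hence "[int x = int D * int y] (mod int p) \<longleftrightarrow> x = D * y"
          using xp p1 cong_less_modulus_unique_nat[of x "D * y" p]
          by (auto simp flip: of_nat_mult simp: cong_int_iff)
        thus ?thesis using D0 by auto
      qed
      hence "(\<Sum>y=1..M. if [int x = int D * int y] (mod int p) then 1 else 0 :: nat)
          = (\<Sum>y=1..M. if D dvd x \<and> y = x div D then 1 else 0)"
        by (intro sum.cong refl) simp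
      also have "\<dots> = (if D dvd x then 1 else 0)"
      proof (cases "D dvd x")
        case True
        then obtain z where z: "x = D * z" ..
        have "z \<in> {1..M}" using z xp D0 DM[symmetric] by auto
        thus ?thesis using z D0 by simp
      qed simp
      finally show ?thesis .
    qed
    thus ?thesis by (simp add: card_eq_sum sum.inter_filter[OF fin] del: sum_constant One_nat_def)
  qed
  have "complex_of_real (real p * real (card {x\<in>A. D dvd x})) = (\<Sum>t<p. F t * cnj (G t))"
    unfolding F_def G_def using p1 by (subst sum_add_char_times) (simp_all only: count, simp_all)
  also have "{..<p} = insert 0 {1..p-1}" using p1 by auto
  also have "(\<Sum>t\<in>insert 0 {1..p-1}. F t * cnj (G t)) = of_nat (card A * M) + (\<Sum>t=1..p-1. F t * cnj (G t))"
    by (subst sum.insert) (simp_all add: F_def G_def)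
  finally have eq: "complex_of_real (real p * real (card {x\<in>A. D dvd x}) - real (card A * M))
      = (\<Sum>t=1..p-1. F t * cnj (G t))" by simp
  have "\<bar>real p * real (card {x\<in>A. D dvd x}) - real (card A * M)\<bar> = norm (\<Sum>t=1..p-1. F t * cnj (G t))"
    by (simp only: eq[symmetric] norm_of_real)
  also have "\<dots> \<le> (\<Sum>t=1..p-1. K * norm (G t))"
    using K p1 by (intro sum_norm_le) (auto simp: norm_mult F_def intro!: mult_right_mono)
  also have "\<dots> = K * (\<Sum>t=1..p-1. norm (G t))" by (simp add: sum_distrib_left)
  also have "(\<Sum>t=1..p-1. norm (G t)) = (\<Sum>s=1..p-1. norm (\<Sum>y=1..M. add_char p (int s * int y)))"
  proof -
    define m where "m t = t * D mod p" for t
    have "m ` {1..p-1} \<subseteq> {1..p-1}"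
    proof safe
      fix t assume t: "t \<in> {1..p-1}"
      have "\<not> p dvd t" using t by (auto dest: dvd_imp_le)
      hence "\<not> p dvd t * D" using copD p by (metis coprime_commute coprime_dvd_mult_left_iff)
      hence "m t \<noteq> 0" by (simp add: m_def mod_eq_0_iff_dvd)
      moreover have "m t < p" using p1 by (simp add: m_def)
      ultimately show "m t \<in> {1..p-1}" by simp
    qed
    moreover have inj: "inj_on m {1..p-1}"
    proof (rule inj_onI)
      fix s t assume st: "s \<in> {1..p-1}" "t \<in> {1..p-1}" "m s = m t"
      hence "[s = t] (mod p)" using copD by (simp add: m_def cong_mult_rcancel_nat flip: cong_def)
      thus "s = t" using st by (auto simp: cong_def)
    qed
    ultimately have "m ` {1..p-1} = {1..p-1}" by (simp add: endo_inj_surj)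
    hence "(\<Sum>s=1..p-1. norm (\<Sum>y=1..M. add_char p (int s * int y)))
        = (\<Sum>t=1..p-1. norm (\<Sum>y=1..M. add_char p (int (m t) * int y)))"
      using sum.reindex[OF inj, of "\<lambda>s. norm (\<Sum>y=1..M. add_char p (int s * int y))"] by simp
    moreover have "add_char p (int (m t) * int y) = add_char p (int t * (int D * int y))" for t y
      using p1 by (intro add_char_cong)
        (auto simp: m_def cong_def zmod_int mod_mult_left_eq simp flip: mult.assoc)
    ultimately show ?thesis by (simp add: G_def)
  qed
  also have "K * \<dots> \<le> K * (real p * (1 + ln (real p)))"
    using K0 p1 by (intro mult_left_mono sum_norm_sum_add_char_le)
  finally have *: "\<bar>real p * real (card {x\<in>A. D dvd x}) - real (card A * M)\<bar> \<le> real p * (K * (1 + ln (real p)))"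
    by (simp add: mult_ac)
  have "real (card A) * real (p - 1) / real p / real D = real (card A * M) / real p"
    using D0 by (simp only: DM[symmetric] of_nat_mult) simp
  hence "\<bar>real (card {x\<in>A. D dvd x}) - real (card A) * real (p - 1) / real p / real D\<bar>
     = \<bar>(real p * real (card {x\<in>A. D dvd x}) - real (card A * M)) / real p\<bar>"
    using p1 by (simp only: diff_divide_distrib) simp
  also have "\<dots> \<le> K * (1 + ln (real p))"
    using * p1 by (simp add: abs_divide pos_divide_le_eq mult.commute)
  finally show ?thesis .
qed

section \<open>Sieving and power residues\<close>

text \<open>Induction on the set of sieving primes: the count for \<open>D\<close> avoiding a new
  prime \<open>q\<close> is the count for \<open>D\<close> minus that for \<open>D * q\<close>. The
  modulus \<open>D\<close> is carried along to make this possible, and each prime doubles the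
  error.\<close>

lemma sieve_estimate:
  fixes A P :: "nat set" and X E :: real
  assumes "finite A" "finite P" "\<And>q. q \<in> P \<Longrightarrow> prime q" "\<And>q. q \<in> P \<Longrightarrow> coprime q D"
    and "\<And>d. d dvd D * \<Prod>P \<Longrightarrow> \<bar>real (card {x\<in>A. d dvd x}) - X / real d\<bar> \<le> E"
  shows "\<bar>real (card {x\<in>A. D dvd x \<and> (\<forall>q\<in>P. \<not> q dvd x)}) - X / real D * (\<Prod>q\<in>P. 1 - 1 / real q)\<bar>
           \<le> 2 ^ card P * E"
  using assms(2-)
proof (induction P arbitrary: D rule: finite_induct)
  case empty
  thus ?case by simp
next
  case (insert q P)
  define S where "S D = {x\<in>A. D dvd x \<and> (\<forall>q\<in>P. \<not> q dvd x)}" for D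
  define c where "c = (\<Prod>q\<in>P. 1 - 1 / real q)"
  have q: "prime q" "coprime q D" using insert.prems by auto
  hence q0: "q > 0" using prime_gt_0_nat by blast
  have "coprime r q" if "r \<in> P" for r
    using that insert by (metis insertCI primes_coprime)
  hence cop: "coprime r (D * q)" if "r \<in> P" for r
    using that insert.prems(2) by simp
  have prod_eq: "\<Prod>(insert q P) = q * \<Prod>P"
    using insert.hyps by simp
  have "\<bar>real (card (S D)) - X / real D * c\<bar> \<le> 2 ^ card P * E"
    unfolding S_def c_def
  proof (rule insert.IH)
    show "\<bar>real (card {x\<in>A. d dvd x}) - X / real d\<bar> \<le> E" if "d dvd D * \<Prod>P" for d
      by (rule insert.prems(3)) (use dvd_mult[OF that, of q] in \<open>simp only: prod_eq mult_ac\<close>)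
  qed (use insert.prems in auto)
  moreover have "\<bar>real (card (S (D * q))) - X / real (D * q) * c\<bar> \<le> 2 ^ card P * E"
    unfolding S_def c_def
  proof (rule insert.IH)
    show "\<bar>real (card {x\<in>A. d dvd x}) - X / real d\<bar> \<le> E" if "d dvd D * q * \<Prod>P" for d
      by (rule insert.prems(3)) (use that in \<open>simp add: prod_eq mult_ac\<close>)
  qed (use insert.prems cop in auto)
  moreover have "real (card {x\<in>A. D dvd x \<and> (\<forall>r\<in>insert q P. \<not> r dvd x)}) = real (card (S D)) - real (card (S (D * q)))"
  proof -
    have "{x\<in>A. D dvd x \<and> (\<forall>r\<in>insert q P. \<not> r dvd x)} = S D - S (D * q)"
      using q by (auto simp: S_def coprime_commute intro: divides_mult dest: dvd_mult_left dvd_mult_right)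
    moreover have "S (D * q) \<subseteq> S D"
      by (auto simp: S_def dest: dvd_mult_left)
    moreover have "finite (S D)" using assms(1) by (simp add: S_def)
    ultimately show ?thesis
      by (simp add: card_Diff_subset card_mono finite_subset of_nat_diff)
  qed
  moreover have "X / real D * (\<Prod>r\<in>insert q P. 1 - 1 / real r) = X / real D * c - X / real (D * q) * c"
    using insert.hyps by (simp add: c_def left_diff_distrib right_diff_distrib)
  moreover have "2 ^ card (insert q P) * E = 2 ^ card P * E + 2 ^ card P * E"
    using insert.hyps by simp
  ultimately show ?case by linarith
qed

lemma coprime_iff_no_prime_factor:
  fixes n x :: nat
  assumes "n > 0"
  shows "coprime x n \<longleftrightarrow> (\<forall>q\<in>prime_factors n. \<not> q dvd x)"
proof
  assume "coprime x n"
  thus "\<forall>q\<in>prime_factors n. \<not> q dvd x"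
    by (metis coprime_common_divisor in_prime_factors_iff not_prime_unit)
next
  assume *: "\<forall>q\<in>prime_factors n. \<not> q dvd x"
  show "coprime x n"
  proof (rule ccontr)
    assume "\<not> coprime x n"
    then obtain q where "prime q" "q dvd x" "q dvd n"
      using prime_factor_nat[of "gcd x n"] by (metis coprime_iff_gcd_eq_1 gcd_nat.bounded_iff)
    with * assms show False by (auto simp: in_prime_factors_iff)
  qed
qed

lemma prod_prime_factors_dvd:
  fixes n :: nat
  assumes "n > 0"
  shows "\<Prod>(prime_factors n) dvd n"
proof -
  have "\<Prod>(prime_factors n) dvd (\<Prod>q\<in>prime_factors n. q ^ multiplicity q n)"
    by (intro prod_dvd_prod) (auto simp: prime_factors_multiplicity intro!: dvd_power)
  also have "\<dots> = n" using assms by (simp add: prod_prime_factors)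
  finally show ?thesis .
qed

text \<open>The sieve over all prime factors of \<open>n\<close> with \<open>D = 1\<close>; the
  Euler product of the factors 1 - 1/q is the totient ratio.\<close>

lemma card_coprime_ge:
  assumes A: "finite A"
    and est: "\<And>d. d dvd n \<Longrightarrow> \<bar>real (card {x\<in>A. d dvd x}) - X / real d\<bar> \<le> E" and n: "n > 0"
  shows "X * (real (totient n) / real n) - 2 ^ card (prime_factors n) * E \<le> real (card {x\<in>A. coprime x n})"
proof -
  have "\<bar>real (card {x\<in>A. 1 dvd x \<and> (\<forall>q\<in>prime_factors n. \<not> q dvd x)}) - X / real 1 * (\<Prod>q\<in>prime_factors n. 1 - 1 / real q)\<bar>
           \<le> 2 ^ card (prime_factors n) * E"
    by (rule sieve_estimate)
       (use A prod_prime_factors_dvd[OF n] in \<open>auto intro!: est intro: dvd_trans\<close>)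
  moreover have "(\<Prod>q\<in>prime_factors n. 1 - 1 / real q) = real (totient n) / real n"
    using n by (simp add: totient_formula2)
  ultimately show ?thesis
    using coprime_iff_no_prime_factor[OF n] by simp
qed

section \<open>QNRNPs as powers of a primitive root, and their fixed points\<close>

lemma QNRNP_cong:
  assumes "[a = b] (mod int p)"
  shows "QNRNP p a \<longleftrightarrow> QNRNP p b"
proof -
  have "coprime a (int p) \<longleftrightarrow> coprime b (int p)"
    using assms by (metis cong_imp_coprime cong_sym)
  moreover have "QuadRes (int p) a \<longleftrightarrow> QuadRes (int p) b"
    unfolding QuadRes_def using assms cong_trans cong_sym by meson
  moreover have "primitive_root p a \<longleftrightarrow> primitive_root p b"
    using assms by (simp add: primitive_root_def cong_def)
  ultimately show ?thesis by (simp add: QNRNP_def quadratic_nonresidue_def)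
qed

text \<open>If \<open>g ^ m\<close> were a square, raising it to the power (p - 1)/2 would give 1,
  which forces \<open>m\<close> to be even. The common factor \<open>l\<close> of \<open>m\<close>
  and \<open>p - 1\<close> makes the order of \<open>g ^ m\<close> divide (p - 1)/l, so it does not
  generate.\<close>

lemma QNRNP_primroot_power:
  assumes p: "prime p" and g: "residue_primroot p g" and l: "l dvd p - 1" "l > 1" "l dvd m" and m: "odd m"
    and p2: "odd p"
  shows "QNRNP p (int (g ^ m))"
proof -
  have p1: "p > 1" using p prime_gt_1_nat by blast
  have cop: "coprime p g" and ord: "ord p g = p - 1"
    using g p by (auto simp: residue_primroot_def totient_prime)
  have cop_m: "coprime (g ^ m) p" using cop by (simp add: coprime_commute)
  have even_n: "even (p - 1)" using p2 by simp
  have "\<not> QuadRes (int p) (int (g ^ m))"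
  proof
    assume "QuadRes (int p) (int (g ^ m))"
    then obtain y where y: "[y\<^sup>2 = int (g ^ m)] (mod int p)" by (auto simp: QuadRes_def)
    define z where "z = nat (y mod int p)"
    have z: "[y = int z] (mod int p)" using p1 by (simp add: z_def cong_def)
    have "[int (z\<^sup>2) = int (g ^ m)] (mod int p)"
      using cong_trans[OF cong_sym[OF cong_pow[OF z, of 2]] y] by simp
    hence zg: "[z\<^sup>2 = g ^ m] (mod p)" by (simp only: cong_int_iff)
    have "coprime (z\<^sup>2) p" using zg cop_m by (metis cong_imp_coprime cong_sym)
    hence copz: "coprime z p" by simp
    have "[(z\<^sup>2) ^ ((p - 1) div 2) = (g ^ m) ^ ((p - 1) div 2)] (mod p)"
      using zg by (rule cong_pow)
    moreover have "(z\<^sup>2) ^ ((p - 1) div 2) = z ^ (p - 1)"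
      using even_n by (simp flip: power_mult)
    moreover have "[z ^ (p - 1) = 1] (mod p)"
      using copz p euler_theorem[of z p] by (simp add: totient_prime)
    ultimately have "[g ^ (m * ((p - 1) div 2)) = 1] (mod p)"
      by (metis cong_sym cong_trans power_mult)
    hence "p - 1 dvd m * ((p - 1) div 2)" using ord by (simp only: ord_divides)
    hence "((p - 1) div 2) * 2 dvd ((p - 1) div 2) * m" using even_n by (simp add: mult.commute)
    moreover have "(p - 1) div 2 \<noteq> 0" using p2 p1 by presburger
    ultimately have "2 dvd m" by (metis dvd_times_left_cancel_iff)
    thus False using m by simp
  qed
  moreover have "\<not> primitive_root p (int (g ^ m))"
  proof
    assume "primitive_root p (int (g ^ m))"
    hence "residue_primroot p (g ^ m mod p)" by (simp add: primitive_root_def nat_mod_distrib flip: of_nat_power of_nat_mod)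
    hence ord': "ord p (g ^ m) = p - 1" using p by (simp add: residue_primroot_def totient_prime)
    obtain c where c: "m = l * c" using l(3) ..
    obtain k where k: "p - 1 = l * k" using l(1) ..
    have "[(g ^ m) ^ k = 1] (mod p)"
    proof -
      have "(g ^ m) ^ k = g ^ ((p - 1) * c)" by (simp only: c k mult_ac power_mult[symmetric])
      moreover have "[g ^ ((p - 1) * c) = 1] (mod p)" using ord by (subst ord_divides) simp
      ultimately show ?thesis by simp
    qed
    hence "p - 1 dvd k" using ord' by (simp only: ord_divides)
    moreover have "k > 0" using k p1 by (cases k) auto
    ultimately have "l * k \<le> k" using k by (metis dvd_imp_le)
    thus False using \<open>k > 0\<close> l(2) by simp
  qed
  ultimately show ?thesis
    using cop_m by (simp add: QNRNP_def quadratic_nonresidue_def coprime_int_iff[symmetric] del: coprime_int_iff)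
qed

text \<open>The witness is \<open>x ^ y\<close> with \<open>y\<close> inverse to \<open>x\<close>
  modulo \<open>p - 1\<close>: its \<open>x\<close>-th power is \<open>x\<close> since the order of
  \<open>x\<close> divides \<open>p - 1\<close>. It is again a power of \<open>g\<close> with an odd
  exponent divisible by \<open>l\<close>.\<close>

lemma QNRNP_fixed_point:
  assumes p: "prime p" "odd p" and g: "residue_primroot p g" and l: "l dvd p - 1" "l > 1" "l dvd m" and m: "odd m"
    and x: "[x = g ^ m] (mod p)" "coprime x (p - 1)"
  shows "\<exists>h :: int. QNRNP p h \<and> QNRNP p (int x) \<and> [h ^ x = int x] (mod int p)"
proof -
  have p1: "p > 1" using p prime_gt_1_nat by blast
  have "coprime p g" using g by (simp add: residue_primroot_def)
  hence "coprime (g ^ m) p" by (simp add: coprime_commute)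
  hence copx: "coprime x p" using x(1) by (metis cong_imp_coprime cong_sym)
  obtain y where y: "[x * y = 1] (mod p - 1)"
    using cong_solve_coprime_nat[OF x(2)] by auto
  have "odd y"
  proof -
    \<comment> \<open>\<open>p - 1\<close> is even, so the inverse relation survives modulo
      2.\<close>
    have "[x * y = 1] (mod 2)" using y p by (rule_tac cong_dvd_modulus_nat[of _ _ "p - 1"]) auto
    thus ?thesis by (metis cong_0_iff cong_sym cong_trans dvd_mult even_mult_iff odd_one cong_dvd_iff)
  qed
  have xy: "[x ^ y = g ^ (m * y)] (mod p)"
    using cong_pow[OF x(1), of y] by (simp add: power_mult)
  have "[(x ^ y) ^ x = x] (mod p)"
  proof -
    have "ord p x dvd p - 1"
      using order_divides_totient[of p x] copx p by (simp add: totient_prime coprime_commute)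
    hence "[y * x = 1] (mod ord p x)"
      using y by (metis cong_dvd_modulus_nat mult.commute)
    hence "[x ^ (y * x) = x ^ 1] (mod p)"
      using copx by (subst order_divides_expdiff) (simp_all add: coprime_commute)
    thus ?thesis by (simp add: power_mult)
  qed
  hence "[int (x ^ y) ^ x = int x] (mod int p)"
    by (simp only: of_nat_power[symmetric] cong_int_iff)
  moreover have "QNRNP p (int (x ^ y))"
    using QNRNP_primroot_power[OF p(1) g l(1,2), of "m * y"] l(3) m \<open>odd y\<close> p(2)
      QNRNP_cong[of "int (x ^ y)" "int (g ^ (m * y))" p] xy by (simp only: cong_int_iff dvd_mult2 even_mult_iff) simp
  moreover have "QNRNP p (int x)"
    using QNRNP_primroot_power[OF p(1) g l m p(2)]
      QNRNP_cong[of "int x" "int (g ^ m)" p] x(1) by (simp only: cong_int_iff)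
  ultimately show ?thesis by blast
qed

section \<open>Numerical estimates\<close>

text \<open>The lower bound on \<open>ln (ln x)\<close> is smallest at \<epsilon> = 1/11, where 1/2
  - \<epsilon> is 9/22. Hence \<open>ln x\<close> exceeds 6.83^(22/9), about 109.6.\<close>

lemma ln_ge_108:
  fixes x \<epsilon> :: real
  assumes "ln x > 0" "1 / 11 \<le> \<epsilon>" "\<epsilon> < 1 / 2" "ln (ln x) > ln 6.83 / (1 / 2 - \<epsilon>)"
  shows "ln x > 108"
proof -
  have "ln 6.83 / (9 / 22) \<le> ln 6.83 / (1 / 2 - \<epsilon>)"
    using assms by (intro divide_left_mono) auto
  also note assms(4)
  finally have "22 * ln 6.83 < 9 * ln (ln x)" by simp
  hence "ln (6.83 ^ 22) < ln (ln x ^ 9)"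
    using assms(1) by (simp add: ln_realpow)
  hence "(6.83 :: real) ^ 22 < ln x ^ 9"
    using assms(1) by (subst (asm) ln_less_cancel_iff) auto
  moreover have "(108 :: real) ^ 9 \<le> 6.83 ^ 22"
    by (simp add: power_divide)
  ultimately have "108 ^ 9 < ln x ^ 9" by linarith
  thus ?thesis by (rule power_less_imp_less_base) (use assms(1) in simp)
qed

text \<open>The tangent line of exp at 9, that is at L = 108, already suffices. With
  \<open>L = ln p\<close> it says that p^(1/12) outgrows 16 ln p.\<close>

lemma exp_ge_linear:
  fixes L :: real
  assumes "L \<ge> 108"
  shows "exp (L / 12) \<ge> 16 * L"
proof -
  \<comment> \<open>5/2 is the quadratic Taylor polynomial of exp at 1, and its ninth power exceeds
    3814.\<close>
  have "(5 / 2 :: real) ^ 9 \<le> exp 1 ^ 9"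
    using exp_lower_Taylor_quadratic[of 1] by (intro power_mono) auto
  also have "exp 1 ^ 9 = exp (9 :: real)"
    by (simp flip: exp_of_nat_mult)
  finally have e9: "3814 \<le> exp (9 :: real)" by (simp add: power_divide)
  have "16 * L \<le> 3814 * (1 + (L / 12 - 9))" using assms by simp
  also have "\<dots> \<le> exp 9 * exp (L / 12 - 9)"
    using assms e9 exp_ge_add_one_self[of "L / 12 - 9"] by (intro mult_mono) auto
  also have "\<dots> = exp (L / 12)" by (simp flip: exp_add)
  finally show ?thesis .
qed

section \<open>Prime factors and the totient\<close>

text \<open>A cubed form of the bound that the totient is at least about n^(2/3) / 12 times 2 to the
  number of prime factors. As \<open>n\<close> is at least its radical, it reduces to a product of
  local factors \<open>h q\<close> = (q - 1)^3 / (8 q^2).\<close>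

lemma totient_cube_ge:
  fixes n :: nat
  assumes n: "n > 0"
  shows "(2 ^ card (prime_factors n)) ^ 3 * real n ^ 2 \<le> 1700 * real (totient n) ^ 3"
proof -
  \<comment> \<open>\<open>S\<close> collects the primes with \<open>h q\<close> below 1; the
    product of \<open>h\<close> over \<open>S\<close> is about 1/1633. Primes of \<open>S\<close>
    missing from \<open>P\<close> only help.\<close>
  define P S :: "nat set" where "P = prime_factors n" and "S = {2, 3, 5, 7}"
  define c h :: "nat \<Rightarrow> real" where "c q = (1 - 1 / real q) ^ 3 / 8" and "h q = real q * c q" for q
  have fin: "finite P" "finite S" by (auto simp: P_def S_def)
  have prime: "prime q" if "q \<in> P" for q using that by (auto simp: P_def)
  have h0: "h q \<ge> 0" if "q \<in> P" for q
    using prime[OF that, THEN prime_gt_1_nat] by (simp add: h_def c_def)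
  have "1 / 1700 \<le> (\<Prod>q\<in>S. h q)"
    by (simp add: S_def h_def c_def power_divide)
  also have "(\<Prod>q\<in>S. h q) = (\<Prod>q\<in>P \<inter> S. h q) * (\<Prod>q\<in>S - P. h q)"
    using fin by (subst prod.union_disjoint[symmetric]) (auto intro: prod.cong)
  also have "\<dots> \<le> (\<Prod>q\<in>P \<inter> S. h q) * 1"
    using h0 by (intro mult_left_mono prod_le_1 prod_nonneg) 
      (auto simp: S_def h_def c_def power_divide)
  also have "\<dots> \<le> (\<Prod>q\<in>P \<inter> S. h q) * (\<Prod>q\<in>P - S. h q)"
  proof (intro mult_left_mono prod_ge_1 prod_nonneg)
    fix q assume q: "q \<in> P - S"
    have "q \<noteq> 4 \<and> q \<noteq> 6 \<and> q \<noteq> 8 \<and> q \<noteq> 9 \<and> q \<noteq> 10"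
      using prime[of q] q by (auto simp: prime_nat_numeral_eq)
    moreover have "q > 1" using prime[of q] q prime_gt_1_nat by auto
    ultimately have "q \<ge> 11" using q by (auto simp: S_def)
    then obtain r where r: "q = r + 11" using le_Suc_ex by (metis add.commute)
    \<comment> \<open>In terms of \<open>r\<close> the difference is r^3 + 22 r^2 + 124 r +
      32.\<close>
    have "8 * real q ^ 2 \<le> (real q - 1) ^ 3"
      by (simp add: r power2_eq_square power3_eq_cube algebra_simps)
    moreover have "1 - 1 / real q = (real q - 1) / real q"
      using r by (simp add: field_simps)
    hence "h q = (real q - 1) ^ 3 / (8 * real q ^ 2)"
      by (simp add: h_def c_def power_divide power2_eq_square power3_eq_cube)
    ultimately show "1 \<le> h q" using r by simp
  qed (use h0 in auto)
  also have "\<dots> = (\<Prod>q\<in>P. h q)"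
    using fin by (subst prod.union_disjoint[symmetric]) (auto intro: prod.cong)
  also have "\<dots> = real (\<Prod>P) * (\<Prod>q\<in>P. c q)"
    by (simp add: h_def prod.distrib)
  also have "\<dots> \<le> real n * (\<Prod>q\<in>P. c q)"
  proof (intro mult_right_mono prod_nonneg)
    show "real (\<Prod>P) \<le> real n"
      using prod_prime_factors_dvd[OF n] n by (simp only: P_def of_nat_le_iff dvd_imp_le)
    show "c q \<ge> 0" if "q \<in> P" for q
      using prime[OF that, THEN prime_gt_1_nat] by (simp add: c_def)
  qed
  also have "(\<Prod>q\<in>P. c q) = (\<Prod>q\<in>P. 1 - 1 / real q) ^ 3 / 8 ^ card P"
    by (simp add: c_def prod_dividef prod_power_distrib)
  also have "(\<Prod>q\<in>P. 1 - 1 / real q) = real (totient n) / real n"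
    using n by (simp add: totient_formula2 P_def)
  finally have "1 / 1700 \<le> real n * ((real (totient n) / real n) ^ 3 / 8 ^ card P)" .
  also have "\<dots> = real (totient n) ^ 3 / (8 ^ card P * real n ^ 2)"
    using n by (simp add: power_divide power2_eq_square power3_eq_cube mult_ac)
  finally have "8 ^ card P * real n ^ 2 \<le> 1700 * real (totient n) ^ 3"
    using n by (simp add: field_simps)
  moreover have "(8 :: real) ^ card P = (2 ^ card P) ^ 3"
    by (simp flip: power_mult add: mult.commute[of "card P"]) (simp add: power_mult)
  ultimately show ?thesis by (simp add: P_def)
qed

text \<open>The radical of \<open>n\<close> is at least 2 to the number of its prime factors, and ln
  2 is at least 2/3.\<close>

lemma card_prime_factors_le_ln:
  fixes n :: nat
  assumes n: "n > 0"
  shows "real (card (prime_factors n)) \<le> 3 / 2 * ln (real n)"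
proof -
  have "2 ^ card (prime_factors n) = (\<Prod>q\<in>prime_factors n. 2 :: nat)" by simp
  also have "\<dots> \<le> \<Prod>(prime_factors n)"
    by (intro prod_mono) (auto dest!: in_prime_factors_imp_prime prime_ge_2_nat)
  also have "\<dots> \<le> n" using prod_prime_factors_dvd[OF n] n by (rule dvd_imp_le)
  finally have "(2 :: real) ^ card (prime_factors n) \<le> real n"
    by (metis of_nat_le_iff of_nat_numeral of_nat_power)
  hence "ln (2 ^ card (prime_factors n)) \<le> ln (real n)"
    using n by (subst ln_le_cancel_iff) auto
  hence "real (card (prime_factors n)) * ln 2 \<le> ln (real n)"
    by (simp add: ln_realpow)
  moreover have "real (card (prime_factors n)) * (2 / 3) \<le> real (card (prime_factors n)) * ln 2"
    using ln2_ge_two_thirds by (intro mult_left_mono) auto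
  ultimately show ?thesis by linarith
qed

text \<open>Without the factor 1/2 at the prime 2, the Euler product over the odd primes
  \<open>Q\<close> is at most 9/11. With \<open>l\<close> the least of them, Bernoulli's inequality
  bounds that product below by 1 - |Q|/l.\<close>

lemma small_odd_prime_factor:
  fixes n :: nat
  assumes n: "n > 0" "even n" and "real (totient n) / real n \<le> 9 / 22"
  obtains l where "prime l" "odd l" "l dvd n" "real l \<le> 11 / 2 * real (card (prime_factors n))"
proof -
  define Q where "Q = prime_factors n - {2}"
  have fin: "finite Q" by (simp add: Q_def)
  have two: "2 \<in> prime_factors n" using n by (simp add: in_prime_factors_iff)
  have "(\<Prod>q\<in>prime_factors n. 1 - 1 / real q) = 1 / 2 * (\<Prod>q\<in>Q. 1 - 1 / real q)"
    using two by (subst prod.remove[of _ 2]) (auto simp: Q_def)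
  hence Q_le: "(\<Prod>q\<in>Q. 1 - 1 / real q) \<le> 9 / 11"
    using assms(3) n by (simp add: totient_formula2)
  hence "Q \<noteq> {}" by auto
  define l where "l = Min Q"
  have l: "l \<in> Q" "\<And>q. q \<in> Q \<Longrightarrow> l \<le> q" using fin \<open>Q \<noteq> {}\<close> by (auto simp: l_def)
  have prime: "prime l" "l dvd n" "l \<noteq> 2" using l(1) by (auto simp: Q_def)
  have l1: "l > 1" using prime(1) by (rule prime_gt_1_nat)
  have "1 + real (card Q) * (- 1 / real l) \<le> (1 + (- 1 / real l)) ^ card Q"
    using l1 by (intro Bernoulli_inequality) (simp add: field_simps)
  also have "\<dots> = (\<Prod>q\<in>Q. 1 - 1 / real l)" by simp
  also have "\<dots> \<le> (\<Prod>q\<in>Q. 1 - 1 / real q)"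
    using l1 l(2) by (intro prod_mono conjI diff_left_mono frac_le) auto
  also note Q_le
  finally have "real l \<le> 11 / 2 * real (card Q)" using l1 by (simp add: field_simps)
  also have "card Q \<le> card (prime_factors n)" by (intro card_mono) (auto simp: Q_def)
  hence "11 / 2 * real (card Q) \<le> 11 / 2 * real (card (prime_factors n))" by simp
  finally have "real l \<le> 11 / 2 * real (card (prime_factors n))" .
  moreover have "odd l" using prime primes_dvd_imp_eq two_is_prime_nat by blast
  ultimately show ?thesis using that prime by blast
qed

text \<open>Cubing lets \<open>totient_cube_ge\<close> cancel the power of 2 coming from the sieve.
  What remains is that sqrt p beats a constant times (l (1 + ln p))^3, which is O((ln p)^6).\<close>

lemma main_term_dominates:
  fixes p l :: nat
  assumes L: "ln (real p) > 108" and l: "real l \<le> 11 / 2 * real (card (prime_factors (p - 1)))" "l > 0"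
  shows "real (p - 1) / (2 * real l) * real (totient (p - 1)) / real p
       > 2 ^ card (prime_factors (p - 1)) * (sqrt (real p) * (1 + ln (real p)))"
proof -
  define L n W \<phi> s where "L = ln (real p)" and "n = real (p - 1)" and "W = (2 :: real) ^ card (prime_factors (p - 1))"
    and "\<phi> = real (totient (p - 1))" and "s = sqrt (real p)"
  have L': "L > 108" using L by (simp add: L_def)
  have p0: "real p > 0" using L by (intro ccontr[of "real p > 0"]) auto
  have pL: "real p = exp L" using p0 by (simp add: L_def)
  have "real p > 108" using exp_ge_add_one_self[of L] L' pL by linarith
  hence p1: "p > 108" by simp
  have n_eq: "n = real p - 1" using p1 by (simp add: n_def of_nat_diff)
  \<comment> \<open>A sixth power, to be compared with L^6 through
    \<open>exp_ge_linear\<close>.\<close>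
  have s: "s = exp (L / 12) ^ 6" "s * s = real p" "s > 0"
  proof -
    have "exp (L / 12) ^ 6 = exp (L / 2)" by (simp flip: exp_of_nat_mult)
    also have "\<dots> = s" using exp_add[of "L / 2" "L / 2"]
      by (simp add: s_def pL real_sqrt_unique power2_eq_square)
    finally show "s = exp (L / 12) ^ 6" ..
  qed (use p0 in \<open>simp_all add: s_def\<close>)
  have "ln n \<le> L" using p1 by (simp add: L_def n_def)
  hence lL: "real l \<le> 33 / 4 * L"
    using l card_prime_factors_le_ln[of "p - 1"] p1 by (simp add: n_def)
  \<comment> \<open>33/4 is 11/2 times 3/2, and 1 is at most L/100.\<close>
  have "real l * (1 + L) \<le> 33 / 4 * L * (101 / 100 * L)"
    using lL L' by (intro mult_mono) auto
  also have "\<dots> = 3333 / 400 * L ^ 2" by (simp add: power2_eq_square)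
  finally have "(real l * (1 + L)) ^ 3 \<le> (3333 / 400 * L ^ 2) ^ 3"
    using L' by (intro power_mono) auto
  \<comment> \<open>27200 = 8 * 2 * 1700: the cube of the 2 in \<open>2 * real l\<close>, the loss
    in replacing \<open>p\<close> by \<open>n\<close> in the fifth power, and the constant of
    \<open>totient_cube_ge\<close>.\<close>
  hence "27200 * (real l * (1 + L)) ^ 3 \<le> 27200 * (3333 / 400) ^ 3 * L ^ 6"
    by (simp add: power_mult_distrib power_divide flip: power_mult)
  also have "\<dots> < 16 ^ 6 * L ^ 6"
    using L' by (intro mult_strict_right_mono zero_less_power) (simp_all add: power_divide)
  also have "\<dots> = (16 * L) ^ 6"
    by (simp only: power_mult_distrib)
  also have "\<dots> \<le> exp (L / 12) ^ 6"
    using exp_ge_linear[of L] L' by (intro power_mono) auto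
  also have "\<dots> = s" using s by simp
  finally have s_gt: "27200 * (real l * (1 + L)) ^ 3 < s" .
  have n5: "real p ^ 5 \<le> 2 * n ^ 5"
  proof -
    have "(9 / 10 * real p) ^ 5 \<le> n ^ 5"
      using p1 n_eq by (intro power_mono) auto
    moreover have "real p ^ 5 \<le> 2 * (9 / 10 * real p) ^ 5"
      by (simp add: power_mult_distrib power_divide)
    ultimately show ?thesis by linarith
  qed
  have W0: "W > 0" by (simp add: W_def)
  have \<phi>: "W ^ 3 * n ^ 2 \<le> 1700 * \<phi> ^ 3"
    using totient_cube_ge[of "p - 1"] p1 by (simp add: W_def n_def \<phi>_def)
  have s3: "s ^ 3 = real p * s" by (simp add: power3_eq_cube s(2))
  have "(2 * real l * real p * (W * (s * (1 + L)))) ^ 3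
      = 8 * (real l * (1 + L)) ^ 3 * (W ^ 3 * real p ^ 4 * s)"
    by (simp only: power_mult_distrib s3) (simp add: eval_nat_numeral mult_ac)
  also have "\<dots> < s / 3400 * (W ^ 3 * real p ^ 4 * s)"
    using s_gt s(3) W0 p0 by (intro mult_strict_right_mono) auto
  also have "\<dots> = W ^ 3 * real p ^ 4 * (s * s) / 3400" by simp
  also have "\<dots> = W ^ 3 * real p ^ 5 / 3400"
    by (simp only: s(2)) (simp add: eval_nat_numeral mult_ac)
  also have "\<dots> \<le> W ^ 3 * (2 * n ^ 5) / 3400"
    using n5 W0 by (intro divide_right_mono mult_left_mono) auto
  also have "\<dots> = W ^ 3 * n ^ 2 / 1700 * n ^ 3"
    by (simp add: eval_nat_numeral mult_ac)
  also have "\<dots> \<le> \<phi> ^ 3 * n ^ 3"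
    using \<phi> n_eq p1 by (intro mult_right_mono) auto
  also have "\<dots> = (n * \<phi>) ^ 3" by (simp add: power_mult_distrib)
  finally have "2 * real l * real p * (W * (s * (1 + L))) < n * \<phi>"
    by (rule power_less_imp_less_base) (simp add: n_def \<phi>_def)
  hence "W * (s * (1 + L)) < n * \<phi> / (2 * real l * real p)"
    using l(2) p0 by (simp add: field_simps)
  thus ?thesis by (simp add: W_def s_def L_def n_def \<phi>_def)
qed

section \<open>Existence of the fixed point\<close>

text \<open>\<open>A\<close> is the coset of \<open>g ^ l\<close> modulo the subgroup generated by
  \<open>g ^ (2 * l)\<close>, of index \<open>2 * l\<close>. The coset bound sqrt p on its Fourier
  coefficients feeds the count of multiples of each divisor of \<open>p - 1\<close>, and the sieve
  does the rest.\<close>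

lemma card_coset_coprime_ge:
  fixes p l g :: nat
  assumes p: "prime p" and g: "residue_primroot p g" and l: "2 * l dvd p - 1"
  defines "A \<equiv> (\<lambda>j. g ^ (l * (2 * j + 1)) mod p) ` {..<(p - 1) div (2 * l)}"
  shows "real (p - 1) / (2 * real l) * real (totient (p - 1)) / real p
           - 2 ^ card (prime_factors (p - 1)) * (sqrt (real p) * (1 + ln (real p)))
         \<le> real (card {x\<in>A. coprime x (p - 1)})"
proof -
  define k where "k = (p - 1) div (2 * l)"
  define f where "f j = g ^ (l * (2 * j + 1)) mod p" for j
  define a u where "a = int (g ^ l)" and "u = int (g ^ (2 * l))"
  have p1: "p > 1" using p prime_gt_1_nat by blast
  have n: "p - 1 = 2 * l * k" using l by (simp add: k_def)
  have kl: "k > 0" "l > 0" using n p1 by (auto intro!: Nat.gr0I)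
  have cop: "coprime p g" and ord: "ord p g = 2 * l * k"
    using g p n by (auto simp: residue_primroot_def totient_prime)
  \<comment> \<open>Exponents below the order of \<open>g\<close> are determined by the
    power.\<close>
  have pow_inj: "i = j" if "[g ^ i = g ^ j] (mod p)" "i < 2 * l * k" "j < 2 * l * k" for i j
    using that cop by (subst (asm) order_divides_expdiff) (auto simp: ord cong_less_modulus_unique_nat)
  have f_inj: "inj_on f {..<k}"
  proof (rule inj_onI)
    fix i j assume ij: "i \<in> {..<k}" "j \<in> {..<k}" "f i = f j"
    have less: "l * (2 * i + 1) < 2 * l * k" if "i < k" for i
    proof -
      have "l * (2 * i + 1) < l * (2 * k)" using that kl by (intro mult_strict_left_mono) auto
      thus ?thesis by (simp add: mult_ac)
    qed
    have "l * (2 * i + 1) = l * (2 * j + 1)"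
      using ij less by (intro pow_inj) (auto simp: f_def cong_def)
    thus "i = j" using kl by simp
  qed
  have A: "A = f ` {..<k}" by (simp add: A_def f_def k_def)
  have card_A: "card A = k" using f_inj by (simp add: A card_image)
  have f_cong: "[int (f j) = a * u ^ j] (mod int p)" for j
  proof -
    have "a * u ^ j = int (g ^ (l * (2 * j + 1)))"
      by (simp add: a_def u_def flip: power_mult power_add) (simp add: algebra_simps)
    thus ?thesis by (simp add: f_def zmod_int)
  qed
  have copg: "coprime (int g) (int p)" using cop by (simp add: coprime_commute)
  have A_sub: "A \<subseteq> {1..p-1}"
  proof
    fix x assume "x \<in> A"
    then obtain j where x: "x = f j" by (auto simp: A)
    have "coprime (g ^ (l * (2 * j + 1))) p" using cop by (simp add: coprime_commute)
    hence "\<not> p dvd g ^ (l * (2 * j + 1))"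
      using p1 by (metis coprime_absorb_right less_irrefl nat_dvd_1_iff_1)
    hence "x \<noteq> 0" by (simp add: x f_def mod_eq_0_iff_dvd)
    moreover have "x < p" using p1 by (simp add: x f_def)
    ultimately show "x \<in> {1..p-1}" by simp
  qed
  have K: "norm (\<Sum>x\<in>A. add_char p (int t * int x)) \<le> sqrt (real p)" if t: "0 < t" "t < p" for t
  proof -
    have "(\<Sum>x\<in>A. add_char p (int t * int x)) = (\<Sum>j<k. add_char p (int t * int (f j)))"
      using f_inj by (simp add: A sum.reindex)
    also have "\<dots> = (\<Sum>j<k. add_char p (int t * (a * u ^ j)))"
      using p1 f_cong by (intro sum.cong refl add_char_cong cong_mult) auto
    also have "norm \<dots> \<le> sqrt (real p)"
    proof (rule norm_coset_sum_le)
      show "p > 0" using p1 by simp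
      have "[g ^ (2 * l * k) = 1] (mod p)" by (subst ord_divides) (simp add: ord)
      hence "[int (g ^ (2 * l * k)) = int 1] (mod int p)" by (simp only: cong_int_iff)
      thus "[u ^ k = 1] (mod int p)" by (simp add: u_def power_mult)
      show "k > 0" by (fact kl)
      show "coprime a (int p)" using copg by (simp add: a_def)
      show "coprime (int t) (int p)"
        using t p by (simp add: coprime_commute nat_dvd_not_less prime_imp_coprime_nat)
      fix i j assume ij: "i < k" "j < k" "[u ^ i = u ^ j] (mod int p)"
      hence "[int (g ^ (2 * l * i)) = int (g ^ (2 * l * j))] (mod int p)"
        by (simp add: u_def power_mult)
      hence "[g ^ (2 * l * i) = g ^ (2 * l * j)] (mod p)" by (simp only: cong_int_iff)
      hence "2 * l * i = 2 * l * j" using ij kl by (intro pow_inj) auto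
      thus "i = j" using kl by simp
    qed
    finally show ?thesis .
  qed
  \<comment> \<open>The sieve runs with X = k (p - 1) / p; the factor \<open>p - 1\<close> then
    cancels against the denominator of the totient ratio.\<close>
  have "real k * real (p - 1) / real p * (real (totient (p - 1)) / real (p - 1))
           - 2 ^ card (prime_factors (p - 1)) * (sqrt (real p) * (1 + ln (real p)))
         \<le> real (card {x\<in>A. coprime x (p - 1)})"
  proof (rule card_coprime_ge)
    show "finite A" by (simp add: A)
    show "p - 1 > 0" using p1 by simp
    show "\<bar>real (card {x\<in>A. d dvd x}) - real k * real (p - 1) / real p / real d\<bar> \<le> sqrt (real p) * (1 + ln (real p))"
      if "d dvd p - 1" for d
      using card_multiples_estimate[OF p A_sub that K] by (simp only: card_A)
  qed
  moreover have "real k = real (p - 1) / (2 * real l)"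
    using n kl by simp
  ultimately show ?thesis using p1 by simp
qed

theorem corollary1p1:
  fixes \<epsilon> :: real and p :: nat
  assumes "\<epsilon> \<in> {1 / 11 ..< 1 / 2}"
    and "prime p"
    and "ln (ln (real p)) > ln 6.83 / (1 / 2 - \<epsilon>)"
    and "real (totient (p - 1)) / real (p - 1) \<le> 1 / 2 - \<epsilon>"
  shows "\<exists>g :: int. QNRNP p g \<and>
    (\<exists>x :: nat. x \<in> {1..p - 1} \<and> QNRNP p (int x) \<and> [g ^ x = int x] (mod int p))"
proof -
  have p1: "p > 1" using assms(2) by (rule prime_gt_1_nat)
  hence "ln (real p) > 0" by simp
  hence L: "ln (real p) > 108" using assms by (intro ln_ge_108[of _ \<epsilon>]) auto
  have "p \<noteq> 2" using L ln_le_minus_one[of "2 :: real"] by (intro notI) simp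
  hence odd: "odd p" using assms(2) p1 prime_odd_nat by fastforce
  obtain l where l: "prime l" "odd l" "l dvd p - 1" "real l \<le> 11 / 2 * real (card (prime_factors (p - 1)))"
  proof (rule small_odd_prime_factor)
    show "real (totient (p - 1)) / real (p - 1) \<le> 9 / 22"
    proof -
      have "1 / 2 - \<epsilon> \<le> 9 / 22" using assms(1) by simp
      with assms(4) show ?thesis by (rule order_trans)
    qed
  qed (use p1 odd in auto)
  have l1: "l > 1" using l(1) by (rule prime_gt_1_nat)
  have "2 * l dvd p - 1" using odd l by (intro divides_mult) (auto simp: coprime_left_2_iff_odd)
  obtain g where g: "residue_primroot p g"
    using prime_primitive_root_exists[of p] assms(2) p1 by auto
  define A where "A = (\<lambda>j. g ^ (l * (2 * j + 1)) mod p) ` {..<(p - 1) div (2 * l)}"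
  \<comment> \<open>The main term exceeds the sieve error because \<open>l\<close> is of size O(ln
    p).\<close>
  have "0 < real (card {x\<in>A. coprime x (p - 1)})"
    using card_coset_coprime_ge[OF assms(2) g \<open>2 * l dvd p - 1\<close>] main_term_dominates[OF L l(4)] l1
    by (simp add: A_def)
  hence "{x\<in>A. coprime x (p - 1)} \<noteq> {}" by (metis card.empty less_irrefl of_nat_0)
  then obtain j where x: "coprime (g ^ (l * (2 * j + 1)) mod p) (p - 1)" by (auto simp: A_def)
  define x where "x = g ^ (l * (2 * j + 1)) mod p"
  have "\<exists>h. QNRNP p h \<and> QNRNP p (int x) \<and> [h ^ x = int x] (mod int p)"
    by (rule QNRNP_fixed_point[OF assms(2) odd g l(3) l1, of "l * (2 * j + 1)"])
       (use l(2) x in \<open>auto simp: x_def cong_def\<close>)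
  moreover have "x \<in> {1..p - 1}"
  proof -
    have "x \<noteq> 0"
    proof
      assume "x = 0"
      \<comment> \<open>0 is coprime to \<open>p - 1\<close> only when \<open>p - 1\<close> is
        1.\<close>
      hence "p - 1 = 1" using x by (simp add: x_def)
      thus False using \<open>p \<noteq> 2\<close> by simp
    qed
    moreover have "x < p" using p1 by (simp add: x_def)
    ultimately show ?thesis by simp
  qed
  ultimately show ?thesis by blast
qed

end
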